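(* Let $A\in\mathbb{R}^{n\times n}$ be symmetric positive semidefinite, let $p\ge1$, $M\ge1$, and let $X_M=\left(\frac1M\sum_{j=1}^M w_j^TA^pw_j\right)^{1/p}$ with $w_1,\dots,w_M$ independent standard Gaussian random vectors in $\mathbb{R}^n$. If $A$ is nonzero, then the variance of $X_M$ is finite and satisfies $$\operatorname{Var}(X_M)\ \le\ \frac{2\,\|A^p\|_F^2}{M\,\|A\|_{S_p}^{2p-2}} .$$
   Context: For a symmetric positive semidefinite matrix $A\in\mathbb{R}^{n\times n}$ with eigenvalues $\lambda_1,\dots,\lambda_n\ge 0$ and $p\ge1$, the Schatten $p$-norm is $\|A\|_{S_p}=\big(\sum_{j=1}^n\lambda_j^p\big)^{1/p}=(\operatorname{tr}(A^p))^{1/p}$, where $A^p$ is defined through the spectral decomposition; $\|\cdot\|_F$ is the Frobenius norm. The samples $w_j:\Omega\to\mathbb{R}^n$ are independent random vectors on a probability space $(\Omega,\mathcal{F},\mathbb{P})$ whose entries are independent standard normal random variables. *)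

theory Defs
  imports "HOL-Probability.Probability"
begin

definition psd_matrix :: "real^'n^'n \<Rightarrow> bool" where
  "psd_matrix A \<longleftrightarrow> transpose A = A \<and> (\<forall>x. 0 \<le> x \<bullet> (A *v x))"

definition diag_matrix :: "real^'n \<Rightarrow> real^'n^'n" where
  "diag_matrix d = (\<chi> i j. if i = j then d $ i else 0)"

definition spectral_decomposition :: "real^'n^'n \<Rightarrow> real^'n^'n \<Rightarrow> real^'n \<Rightarrow> bool" where
  "spectral_decomposition A U d \<longleftrightarrow>
     orthogonal_matrix U \<and> A = U ** diag_matrix d ** transpose U"

(* The eigenvalues of a symmetric matrix, repeated according to multiplicity.  The order in
   which they are listed is arbitrary. *)
definition eigenvals :: "real^'n^'n \<Rightarrow> real^'n" where
  "eigenvals A = (SOME d. \<exists>U. spectral_decomposition A U d)"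

(* Real powers of a positive semidefinite matrix.  By symmetric_spectral_decomposition and
   matrix_powr_eq below, the description is well-defined for every symmetric matrix. *)
definition matrix_powr :: "real^'n^'n \<Rightarrow> real \<Rightarrow> real^'n^'n" where
  "matrix_powr A p =
     (THE B. \<exists>U d. spectral_decomposition A U d \<and>
                    B = U ** diag_matrix (\<chi> i. d $ i powr p) ** transpose U)"

(* Only meaningful for positive semidefinite matrices, where singular values and
   eigenvalues coincide. *)
definition schatten_norm :: "real \<Rightarrow> real^'n^'n \<Rightarrow> real" where
  "schatten_norm p A = (\<Sum>i\<in>UNIV. eigenvals A $ i powr p) powr (1 / p)"

definition frobenius_norm :: "real^'n^'m \<Rightarrow> real" where
  "frobenius_norm A = sqrt (\<Sum>i\<in>UNIV. \<Sum>j\<in>UNIV. (A $ i $ j)\<^sup>2)"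

definition std_gaussian_vector :: "'a measure \<Rightarrow> ('a \<Rightarrow> real^'n) \<Rightarrow> bool" where
  "std_gaussian_vector \<Omega> X \<longleftrightarrow>
     prob_space.indep_vars \<Omega> (\<lambda>_. borel) (\<lambda>i \<omega>. X \<omega> $ i) UNIV \<and>
     (\<forall>i. distributed \<Omega> lborel (\<lambda>\<omega>. X \<omega> $ i) std_normal_density)"

definition schatten_estimator ::
    "real^'n^'n \<Rightarrow> real \<Rightarrow> nat \<Rightarrow> (nat \<Rightarrow> 'a \<Rightarrow> real^'n) \<Rightarrow> 'a \<Rightarrow> real" where
  "schatten_estimator A p M w \<omega> =
     (1 / real M * (\<Sum>j = 1..M. w j \<omega> \<bullet> (matrix_powr A p *v w j \<omega>))) powr (1 / p)"

lemma frobenius_norm_eq_norm: "frobenius_norm A = norm A"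
  by (simp add: frobenius_norm_def norm_vec_def L2_set_def sum_nonneg)

lemma diag_matrix_mult_nth: "(diag_matrix d ** B) $ i $ j = d $ i * B $ i $ j"
  by (simp add: diag_matrix_def matrix_matrix_mult_def if_distrib[of "\<lambda>x. x * _"] cong: if_cong)

lemma mult_diag_matrix_nth: "(B ** diag_matrix d) $ i $ j = B $ i $ j * d $ j"
  by (simp add: diag_matrix_def matrix_matrix_mult_def if_distrib[of "\<lambda>x. _ * x"] cong: if_cong)

lemma invariant_subspace_eigenbasis:
  fixes A :: "real^'n^'n"
  assumes "transpose A = A" "subspace S" "\<And>x. x \<in> S \<Longrightarrow> A *v x \<in> S"
  shows "\<exists>B. finite B \<and> B \<subseteq> S \<and> S \<subseteq> span B \<and> pairwise orthogonal B \<and>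
             (\<forall>b\<in>B. norm b = 1 \<and> (\<exists>c. A *v b = c *\<^sub>R b))"
  using assms(2,3)
proof (induction "dim S" arbitrary: S rule: less_induct)
  case less
  have sym: "x \<bullet> (A *v y) = (A *v x) \<bullet> y" for x y
    using dot_lmul_matrix[of x A y] assms(1) by (metis transpose_matrix_vector)
  show ?case
  proof (cases "S \<subseteq> {0}")
    case True
    then show ?thesis by (intro exI[of _ "{}"]) auto
  next
    case False
    then obtain v where v: "v \<in> S" "v \<noteq> 0" by auto
    let ?K = "S \<inter> sphere 0 1"
    have "compact ?K"
      by (intro closed_Int_compact closed_subspace less.prems compact_sphere)
    moreover have "v /\<^sub>R norm v \<in> ?K"
      using v less.prems(1) by (simp add: subspace_scale)
    moreover have "continuous_on ?K (\<lambda>x. x \<bullet> (A *v x))"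
      by (intro continuous_intros matrix_vector_mult_linear_continuous_on)
    ultimately obtain u where u: "u \<in> ?K"
        and umax: "\<And>y. y \<in> ?K \<Longrightarrow> y \<bullet> (A *v y) \<le> u \<bullet> (A *v u)"
      using continuous_attains_sup[of ?K "\<lambda>x. x \<bullet> (A *v x)"] by blast
    define m where "m = u \<bullet> (A *v u)"
    have uS: "u \<in> S" and un: "norm u = 1" and uu: "u \<bullet> u = 1"
      using u by (auto simp: norm_eq_1)
    have bound: "y \<bullet> (A *v y) \<le> m * (y \<bullet> y)" if "y \<in> S" for y
    proof (cases "y = 0")
      case False
      have "y /\<^sub>R norm y \<in> ?K" using that False less.prems(1) by (simp add: subspace_scale)
      from umax[OF this] have "(y \<bullet> (A *v y)) / (norm y)\<^sup>2 \<le> m"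
        by (simp add: m_def matrix_vector_mult_scaleR divide_inverse power2_eq_square mult_ac)
      then show ?thesis using False by (simp add: divide_le_eq power2_norm_eq_inner)
    qed simp
    define T where "T = {x \<in> S. x \<bullet> u = 0}"
    have orth: "x \<bullet> (A *v u) = 0" if "x \<in> T" for x
    proof -
      have x: "x \<in> S" "x \<bullet> u = 0" using that by (auto simp: T_def)
      define c where "c = x \<bullet> (A *v u)"
      define K where "K = m * (x \<bullet> x) - x \<bullet> (A *v x)"
      have ineq: "2 * t * c \<le> t\<^sup>2 * K" for t
      proof -
        have "u + t *\<^sub>R x \<in> S" using uS x less.prems(1) by (simp add: subspace_add subspace_scale)
        from bound[OF this] show ?thesis
          using x(2) uu sym[of u x]
          by (simp add: K_def c_def m_def matrix_vector_right_distrib matrix_vector_mult_scaleR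
              inner_add_left inner_add_right inner_commute power2_eq_square algebra_simps)
      qed
      have "K \<ge> 0" using bound[OF x(1)] by (simp add: K_def)
      have "2 * (c / (K + 1)) * c \<le> (c / (K + 1))\<^sup>2 * K" by (rule ineq)
      also have "\<dots> \<le> (c / (K + 1))\<^sup>2 * (K + 1)" by (simp add: mult_left_mono)
      also have "\<dots> = c / (K + 1) * c"
        using \<open>K \<ge> 0\<close> by (simp add: power2_eq_square)
      finally have "c * c / (K + 1) \<le> 0" by simp
      then have "c * c \<le> 0" using \<open>K \<ge> 0\<close> by (simp add: divide_le_0_iff)
      then have "c = 0" by (metis mult_le_0_iff order_antisym)
      then show ?thesis by (simp add: c_def)
    qed
    define r where "r = A *v u - m *\<^sub>R u"
    have AuS: "A *v u \<in> S" using less.prems(2) uS .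
    have "r \<in> S"
      using AuS uS less.prems(1) by (simp add: r_def subspace_diff subspace_scale)
    moreover have "r \<bullet> u = 0"
      using uu by (simp add: r_def m_def inner_diff_left inner_commute[of "A *v u" u])
    ultimately have "r \<in> T" by (simp add: T_def)
    then have "r \<bullet> (A *v u) - m * (r \<bullet> u) = 0" using orth by (simp add: T_def)
    then have "r \<bullet> (A *v u - m *\<^sub>R u) = 0" by (simp add: inner_diff_right)
    then have "r \<bullet> r = 0" unfolding r_def .
    then have eig: "A *v u = m *\<^sub>R u" by (simp add: r_def)
    have subT: "subspace T"
      using less.prems(1) unfolding T_def
      by (auto simp: subspace_def inner_add_left)
    have invT: "A *v x \<in> T" if "x \<in> T" for x
      using that less.prems(2) sym[of x u] eig by (auto simp: T_def)
    have "T \<subseteq> S" "u \<notin> T" using uu by (auto simp: T_def)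
    have "dim T < dim S"
      by (metis \<open>T \<subseteq> S\<close> \<open>u \<notin> T\<close> dim_psubset less.prems(1) psubsetI span_eq_iff subT uS)
    from less.hyps[OF this subT invT] obtain B where B: "finite B" "B \<subseteq> T" "T \<subseteq> span B"
      "pairwise orthogonal B" "\<forall>b\<in>B. norm b = 1 \<and> (\<exists>c. A *v b = c *\<^sub>R b)" by blast
    have "S \<subseteq> span (insert u B)"
    proof
      fix x assume x: "x \<in> S"
      have "x - (x \<bullet> u) *\<^sub>R u \<in> T"
        using x uS uu less.prems(1) by (auto simp: T_def subspace_diff subspace_scale inner_diff_left)
      then show "x \<in> span (insert u B)" using B(3) unfolding span_insert by blast
    qed
    moreover have "pairwise orthogonal (insert u B)"
      using B(2,4) by (auto simp: pairwise_insert T_def orthogonal_def inner_commute)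
    ultimately show ?thesis
      using B(1,2,5) \<open>T \<subseteq> S\<close> uS un eig by (intro exI[of _ "insert u B"]) auto
  qed
qed

lemma symmetric_spectral_decomposition:
  fixes A :: "real^'n^'n"
  assumes "transpose A = A"
  shows "\<exists>U d. spectral_decomposition A U d"
proof -
  obtain B :: "(real^'n) set" where B: "finite B" "UNIV \<subseteq> span B" "pairwise orthogonal B"
      "\<forall>b\<in>B. norm b = 1 \<and> (\<exists>c. A *v b = c *\<^sub>R b)"
    using invariant_subspace_eigenbasis[OF assms, of UNIV] by auto
  have "0 \<notin> B" using B(4) by force
  then have "independent B" using B(3) by (rule pairwise_orthogonal_independent[rotated])
  then have "card B = CARD('n)"
    using B(2) dim_eq_card_independent[of B] dim_eq_full[of B] by (simp add: top.extremum_unique)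
  then obtain f where f: "bij_betw f (UNIV :: 'n set) B"
    using B(1) by (metis finite_same_card_bij finite)
  have fB: "f j \<in> B" for j using f by (auto simp: bij_betw_def)
  then have "\<forall>j. \<exists>c. A *v f j = c *\<^sub>R f j" using B(4) by blast
  then obtain d' where d': "\<forall>j. A *v f j = d' j *\<^sub>R f j" by (rule choice[THEN exE])
  define U :: "real^'n^'n" where "U = (\<chi> i j. f j $ i)"
  define d :: "real^'n" where "d = (\<chi> j. d' j)"
  have col: "column j U = f j" for j by (simp add: U_def column_def vec_eq_iff)
  have U: "orthogonal_matrix U"
    unfolding orthogonal_matrix_orthonormal_columns col
    using fB B(3,4) f by (simp add: pairwise_def bij_betw_def inj_on_def) metis
  have "A ** U = U ** diag_matrix d"
  proof -
    have "(A ** U) $ i $ j = (A *v f j) $ i" for i j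
      by (simp add: matrix_matrix_mult_def matrix_vector_mult_def U_def)
    then show ?thesis
      using d' by (simp add: vec_eq_iff mult_diag_matrix_nth U_def d_def)
  qed
  then have "A = U ** diag_matrix d ** transpose U"
    by (metis U matrix_mul_assoc matrix_mul_rid orthogonal_matrix_def)
  with U show ?thesis unfolding spectral_decomposition_def by blast
qed

lemma spectral_decomposition_fun_unique:
  assumes "spectral_decomposition A U d" "spectral_decomposition A V e"
  shows "U ** diag_matrix (\<chi> i. f (d $ i)) ** transpose U =
         V ** diag_matrix (\<chi> i. f (e $ i)) ** transpose V"
proof -
  define W where "W = transpose V ** U"
  have U: "transpose U ** U = mat 1" "U ** transpose U = mat 1"
    and V: "transpose V ** V = mat 1" "V ** transpose V = mat 1"
    using assms by (auto simp: spectral_decomposition_def orthogonal_matrix_def)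
  have eq: "U ** diag_matrix d ** transpose U = V ** diag_matrix e ** transpose V"
    using assms by (simp add: spectral_decomposition_def)
  have "W ** diag_matrix d = transpose V ** (U ** diag_matrix d ** transpose U) ** U"
    by (metis W_def U(1) matrix_mul_assoc matrix_mul_rid)
  also have "\<dots> = diag_matrix e ** W"
    unfolding eq by (metis W_def V(1) matrix_mul_assoc matrix_mul_lid)
  finally have "W $ i $ j * d $ j = e $ i * W $ i $ j" for i j
    by (metis diag_matrix_mult_nth mult_diag_matrix_nth)
  then have "W $ i $ j * f (d $ j) = f (e $ i) * W $ i $ j" for i j
    by (metis mult.commute mult_cancel_left)
  then have "W ** diag_matrix (\<chi> i. f (d $ i)) = diag_matrix (\<chi> i. f (e $ i)) ** W"
    by (simp add: vec_eq_iff diag_matrix_mult_nth mult_diag_matrix_nth)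
  then have "V ** (W ** diag_matrix (\<chi> i. f (d $ i))) ** transpose U =
             V ** (diag_matrix (\<chi> i. f (e $ i)) ** W) ** transpose U" by simp
  moreover have "V ** W = U" by (metis W_def V(2) matrix_mul_assoc matrix_mul_lid)
  moreover have "W ** transpose U = transpose V"
    by (metis W_def U(2) matrix_mul_assoc matrix_mul_rid)
  ultimately show ?thesis by (metis matrix_mul_assoc)
qed

lemma matrix_powr_eq:
  assumes "spectral_decomposition A U d"
  shows "matrix_powr A p = U ** diag_matrix (\<chi> i. d $ i powr p) ** transpose U"
  unfolding matrix_powr_def
proof (rule the_equality)
  show "\<exists>V e. spectral_decomposition A V e \<and>
          U ** diag_matrix (\<chi> i. d $ i powr p) ** transpose U =
          V ** diag_matrix (\<chi> i. e $ i powr p) ** transpose V"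
    by (intro exI conjI) (rule assms, rule refl)
next
  fix B assume "\<exists>V e. spectral_decomposition A V e \<and>
    B = V ** diag_matrix (\<chi> i. e $ i powr p) ** transpose V"
  then obtain V e where "spectral_decomposition A V e"
    "B = V ** diag_matrix (\<chi> i. e $ i powr p) ** transpose V" by (elim exE conjE)
  then show "B = U ** diag_matrix (\<chi> i. d $ i powr p) ** transpose U"
    using spectral_decomposition_fun_unique[OF _ assms, where f = "\<lambda>x. x powr p"] by simp
qed

lemma schatten_norm_eq_trace:
  assumes "transpose A = A"
  shows "schatten_norm p A = trace (matrix_powr A p) powr (1 / p)"
proof -
  obtain U where dec: "spectral_decomposition A U (eigenvals A)"
    using someI_ex[of "\<lambda>d. \<exists>U. spectral_decomposition A U d"]
      symmetric_spectral_decomposition[OF assms]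
    unfolding eigenvals_def by meson
  let ?D = "diag_matrix (\<chi> i. eigenvals A $ i powr p)"
  have "trace (matrix_powr A p) = trace (transpose U ** (U ** ?D))"
    unfolding matrix_powr_eq[OF dec] by (rule trace_mul_sym)
  also have "\<dots> = trace ?D"
    using dec by (simp add: matrix_mul_assoc spectral_decomposition_def orthogonal_matrix_def)
  also have "\<dots> = (\<Sum>i\<in>UNIV. eigenvals A $ i powr p)"
    by (simp add: trace_def diag_matrix_def)
  finally show ?thesis by (simp add: schatten_norm_def)
qed

lemma spectral_decomposition_charpoly:
  fixes A :: "real^'n^'n"
  assumes "spectral_decomposition A U d"
  shows "det (mat x - A) = (\<Prod>i\<in>UNIV. x - d $ i)"
proof -
  have U: "U ** transpose U = mat 1" and A: "A = U ** diag_matrix d ** transpose U"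
    using assms by (auto simp: spectral_decomposition_def orthogonal_matrix_def)
  have rdist: "(B + C) ** D = B ** D + C ** D" for B C D :: "real^'n^'n"
    by (simp add: vec_eq_iff matrix_matrix_mult_def sum.distrib algebra_simps)
  have "diag_matrix (\<chi> i. x - d $ i) + diag_matrix d = mat x"
    by (simp add: vec_eq_iff diag_matrix_def mat_def)
  moreover have "U ** mat x = mat x ** U"
    by (simp add: vec_eq_iff matrix_matrix_mult_def mat_def if_distrib[of "\<lambda>x. _ * x"]
        if_distrib[of "\<lambda>x. x * _"] cong: if_cong)
  ultimately have "U ** diag_matrix (\<chi> i. x - d $ i) ** transpose U + A = mat x"
    unfolding A by (metis U rdist matrix_add_ldistrib matrix_mul_assoc matrix_mul_rid)
  then have "mat x - A = U ** diag_matrix (\<chi> i. x - d $ i) ** transpose U"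
    by (metis add_diff_cancel_right')
  then have "det (mat x - A) = det (U ** transpose U) * det (diag_matrix (\<chi> i. x - d $ i))"
    by (simp add: det_mul)
  also have "det (diag_matrix (\<chi> i. x - d $ i)) = (\<Prod>i\<in>UNIV. x - d $ i)"
    by (subst det_diagonal) (simp_all add: diag_matrix_def)
  finally show ?thesis unfolding U by simp
qed

end

theory Submission
  imports Defs
begin

text \<open>
  Let \<open>B = A\<^sup>p\<close>, \<open>T = tr B\<close> and let \<open>Y\<close> be the sample mean of the quadratic forms \<open>w\<^sub>j \<bullet> B w\<^sub>j\<close>, so that
  \<open>X\<^sub>M = Y\<^bsup>1/p\<^esup>\<close> and \<open>T\<^bsup>1/p\<^esup>\<close> is the Schatten norm.  The fourth moments of a standard Gaussian vector
  (Isserlis' formula) give \<open>E Y = T\<close> and \<open>Var Y = 2 \<parallel>B\<parallel>\<^sub>F\<^sup>2 / M\<close>.  The map \<open>y \<mapsto> y\<^bsup>1/p\<^esup>\<close> satisfies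
  \<open>\<bar>y\<^bsup>1/p\<^esup> - T\<^bsup>1/p\<^esup>\<bar> \<le> \<bar>y - T\<bar> / T\<^bsup>1-1/p\<^esup>\<close>, and the variance of \<open>X\<^sub>M\<close> is at most its mean square deviation
  from the constant \<open>T\<^bsup>1/p\<^esup>\<close>.
\<close>

section \<open>A scalar estimate for the power \<open>1 / p\<close>\<close>

lemma abs_powr_inverse_diff_le:
  fixes x y p :: real
  assumes "0 \<le> x" "0 < y" "1 \<le> p"
  shows "\<bar>x powr (1 / p) - y powr (1 / p)\<bar> * y powr (1 - 1 / p) \<le> \<bar>x - y\<bar>"
proof -
  \<comment> \<open>After this factorization of \<open>x\<close> and \<open>y\<close>, expanding the
    left-hand side leaves one mixed product \<open>x powr (1 / p) * y powr (1 - 1 / p)\<close>.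
    Monotonicity of its second factor compares it with \<open>x\<close>, in the direction that each
    case requires. The factorization also holds at 0, where \<open>powr\<close> is 0.\<close>
  have split: "s = s powr (1 / p) * s powr (1 - 1 / p)" if "0 \<le> s" for s
    using that by (simp flip: powr_add)
  have e: "0 \<le> 1 - 1 / p" using assms by simp
  show ?thesis
  proof (cases "x \<le> y")
    case True
    then have "x powr (1 / p) \<le> y powr (1 / p)" "x powr (1 - 1 / p) \<le> y powr (1 - 1 / p)"
      using assms e by (auto intro: powr_mono2)
    then have "x powr (1 / p) * x powr (1 - 1 / p) \<le> x powr (1 / p) * y powr (1 - 1 / p)"
      by (intro mult_left_mono) auto
    then show ?thesis
      using True \<open>x powr (1 / p) \<le> _\<close> split[of x] split[of y] assms by (simp add: left_diff_distrib)
  next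
    case False
    then have "y powr (1 / p) \<le> x powr (1 / p)" "y powr (1 - 1 / p) \<le> x powr (1 - 1 / p)"
      using assms e by (auto intro: powr_mono2)
    then have "x powr (1 / p) * y powr (1 - 1 / p) \<le> x powr (1 / p) * x powr (1 - 1 / p)"
      by (intro mult_left_mono) auto
    then show ?thesis
      using False \<open>y powr (1 / p) \<le> _\<close> split[of x] split[of y] assms by (simp add: left_diff_distrib)
  qed
qed

section \<open>Trace and positivity of real powers of a symmetric matrix\<close>

lemma trace_matrix_powr:
  assumes "spectral_decomposition A U d"
  shows "trace (matrix_powr A p) = (\<Sum>i\<in>UNIV. d $ i powr p)"
proof -
  let ?D = "diag_matrix (\<chi> i. d $ i powr p)"
  have "trace (matrix_powr A p) = trace (transpose U ** (U ** ?D))"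
    unfolding matrix_powr_eq[OF assms] by (rule trace_mul_sym)
  also have "\<dots> = trace ?D"
    using assms by (simp add: matrix_mul_assoc spectral_decomposition_def orthogonal_matrix_def)
  finally show ?thesis by (simp add: trace_def diag_matrix_def)
qed

lemma transpose_diag_matrix: "transpose (diag_matrix d) = diag_matrix d"
  by (auto simp: transpose_def diag_matrix_def vec_eq_iff)

text \<open>In eigenvector coordinates the quadratic form is a sum of squares weighted by
  \<open>d $ i powr p\<close>, and \<open>powr\<close> is never negative.\<close>

lemma psd_matrix_powr:
  fixes A :: "real^'n^'n"
  assumes "transpose A = A"
  shows "psd_matrix (matrix_powr A p)"
proof -
  obtain U d where dec: "spectral_decomposition A U d"
    using symmetric_spectral_decomposition[OF assms] by blast
  let ?D = "diag_matrix (\<chi> i. d $ i powr p)"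
  have "x \<bullet> (matrix_powr A p *v x) = (transpose U *v x) \<bullet> (?D *v (transpose U *v x))" for x
    unfolding matrix_powr_eq[OF dec]
    by (metis dot_lmul_matrix matrix_vector_mul_assoc transpose_matrix_vector)
  moreover have "0 \<le> y \<bullet> (?D *v y)" for y :: "real^'n"
  proof -
    have "(?D *v y) $ i = d $ i powr p * y $ i" for i
      by (simp add: matrix_vector_mult_def diag_matrix_def if_distrib[of "\<lambda>x. x * _"] cong: if_cong)
    then have "y \<bullet> (?D *v y) = (\<Sum>i\<in>UNIV. d $ i powr p * (y $ i)\<^sup>2)"
      by (simp add: inner_vec_def power2_eq_square mult_ac)
    then show ?thesis by (simp add: sum_nonneg)
  qed
  moreover have "transpose (matrix_powr A p) = matrix_powr A p"
    unfolding matrix_powr_eq[OF dec]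
    by (simp add: matrix_transpose_mul transpose_diag_matrix matrix_mul_assoc)
  ultimately show ?thesis by (simp add: psd_matrix_def)
qed

text \<open>A nonzero symmetric matrix has a nonzero eigenvalue, and \<open>powr\<close> is positive
  at every nonzero base. This is what permits dividing by a power of the trace later.\<close>

lemma trace_matrix_powr_pos:
  fixes A :: "real^'n^'n"
  assumes "transpose A = A" "A \<noteq> 0"
  shows "0 < trace (matrix_powr A p)"
proof -
  obtain U d where dec: "spectral_decomposition A U d"
    using symmetric_spectral_decomposition[OF assms(1)] by blast
  have "d \<noteq> 0"
  proof
    assume "d = 0"
    then have "diag_matrix d = 0" by (simp add: diag_matrix_def vec_eq_iff)
    then have "A = U ** 0 ** transpose U"
      using dec by (simp add: spectral_decomposition_def)
    then show False using \<open>A \<noteq> 0\<close>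
      by (simp add: matrix_matrix_mult_def vec_eq_iff)
  qed
  then obtain i where "d $ i \<noteq> 0" by (auto simp: vec_eq_iff)
  then show ?thesis
    unfolding trace_matrix_powr[OF dec] by (intro sum_pos2[of _ i]) auto
qed

section \<open>Moments of the standard normal distribution\<close>

definition std_normal_moment :: "nat \<Rightarrow> real" where
  "std_normal_moment k = (LINT x|lborel. std_normal_density x * x ^ k)"

text \<open>The orders are written with \<open>Suc\<close> because the exponents below are sums of
  0/1 indicators, which evaluate to such terms.\<close>

lemma std_normal_moments:
  "std_normal_moment 0 = 1" "std_normal_moment (Suc 0) = 0" "std_normal_moment (Suc (Suc 0)) = 1"
  "std_normal_moment (Suc (Suc (Suc 0))) = 0" "std_normal_moment (Suc (Suc (Suc (Suc 0)))) = 3"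
  using integral_std_normal_moment_even[of 0] integral_std_normal_moment_odd[of 0]
    integral_std_normal_moment_even[of 1] integral_std_normal_moment_odd[of 1]
    integral_std_normal_moment_even[of 2]
  by (simp_all add: std_normal_moment_def eval_nat_numeral fact_numeral)

text \<open>The exponent counts how often \<open>a\<close> occurs among \<open>i\<close> and
  \<open>j\<close>. Absent coordinates contribute the factor 1, and a coordinate occurring exactly
  once contributes 0.\<close>

lemma prod_std_normal_moment_2:
  fixes i j :: "'n::finite"
  shows "(\<Prod>a\<in>UNIV. std_normal_moment (of_bool (a = i) + of_bool (a = j))) = of_bool (i = j)"
proof -
  have "(\<Prod>a\<in>UNIV. std_normal_moment (of_bool (a = i) + of_bool (a = j)))
     = (\<Prod>a\<in>{i, j}. std_normal_moment (of_bool (a = i) + of_bool (a = j)))"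
    by (intro prod.mono_neutral_right) (auto simp: std_normal_moments)
  also have "\<dots> = of_bool (i = j)"
    by (cases "i = j") (auto simp: std_normal_moments)
  finally show ?thesis .
qed

text \<open>Isserlis' formula as a sum over the three pairings of four indices. A value occurring
  once or three times makes the product vanish, two distinct pairs give 1, and when all four agree
  the fourth moment 3 accounts for all three pairings.\<close>

lemma prod_std_normal_moment_4:
  fixes i j k l :: "'n::finite"
  shows "(\<Prod>a\<in>UNIV. std_normal_moment
      (of_bool (a = i) + of_bool (a = j) + of_bool (a = k) + of_bool (a = l))) =
    of_bool (i = j) * of_bool (k = l) + of_bool (i = k) * of_bool (j = l)
      + of_bool (i = l) * of_bool (j = k)"
proof -
  have "(\<Prod>a\<in>UNIV. std_normal_moment
      (of_bool (a = i) + of_bool (a = j) + of_bool (a = k) + of_bool (a = l))) =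
    (\<Prod>a\<in>{i, j, k, l}. std_normal_moment
      (of_bool (a = i) + of_bool (a = j) + of_bool (a = k) + of_bool (a = l)))"
    by (intro prod.mono_neutral_right) (auto simp: std_normal_moments)
  also have "\<dots> = of_bool (i = j) * of_bool (k = l) + of_bool (i = k) * of_bool (j = l)
      + of_bool (i = l) * of_bool (j = k)"
    by (cases "i = j"; cases "i = k"; cases "i = l"; cases "j = k"; cases "j = l"; cases "k = l")
       (auto simp: insert_absorb std_normal_moments)
  finally show ?thesis .
qed

section \<open>Gaussian vectors, their quadratic forms, and variances\<close>

context prob_space
begin

text \<open>Independence of the coordinates factors the expectation, which reduces every mixed
  moment to one-dimensional ones.\<close>

lemma std_gaussian_vector_monomial:
  fixes X :: "'a \<Rightarrow> real^'n" and n :: "'n \<Rightarrow> nat"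
  assumes "std_gaussian_vector M X"
  shows "integrable M (\<lambda>\<omega>. \<Prod>a\<in>UNIV. (X \<omega> $ a) ^ n a)"
    and "expectation (\<lambda>\<omega>. \<Prod>a\<in>UNIV. (X \<omega> $ a) ^ n a) = (\<Prod>a\<in>UNIV. std_normal_moment (n a))"
proof -
  have D: "distributed M lborel (\<lambda>\<omega>. X \<omega> $ a) std_normal_density" for a
    using assms by (auto simp: std_gaussian_vector_def)
  have int: "integrable M (\<lambda>\<omega>. (X \<omega> $ a) ^ n a)" for a
    using distributed_integrable[OF D[of a], of "\<lambda>x. x ^ n a"] integrable_std_normal_moment
    by simp
  have E: "expectation (\<lambda>\<omega>. (X \<omega> $ a) ^ n a) = std_normal_moment (n a)" for a
    using distributed_integral[OF D[of a], of "\<lambda>x. x ^ n a"]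
    by (simp add: std_normal_moment_def)
  have ind: "indep_vars (\<lambda>_. borel) (\<lambda>a \<omega>. (X \<omega> $ a) ^ n a) UNIV"
    using assms
    by (intro indep_vars_compose2[where M' = "\<lambda>_. borel" and X = "\<lambda>a \<omega>. X \<omega> $ a" and Y = "\<lambda>a x. x ^ n a"])
       (auto simp: std_gaussian_vector_def)
  show "integrable M (\<lambda>\<omega>. \<Prod>a\<in>UNIV. (X \<omega> $ a) ^ n a)"
    by (intro indep_vars_integrable ind int) simp
  show "expectation (\<lambda>\<omega>. \<Prod>a\<in>UNIV. (X \<omega> $ a) ^ n a) = (\<Prod>a\<in>UNIV. std_normal_moment (n a))"
    by (subst indep_vars_lebesgue_integral) (auto simp: ind int E)
qed

lemma std_gaussian_vector_moment_2:
  fixes X :: "'a \<Rightarrow> real^'n"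
  assumes "std_gaussian_vector M X"
  shows "integrable M (\<lambda>\<omega>. X \<omega> $ i * X \<omega> $ j)"
    and "expectation (\<lambda>\<omega>. X \<omega> $ i * X \<omega> $ j) = of_bool (i = j)"
proof -
  \<comment> \<open>Each coordinate is raised to its multiplicity among the chosen indices, so that
    the monomial lemma applies.\<close>
  have "x $ i * x $ j = (\<Prod>a\<in>UNIV. (x $ a) ^ (of_bool (a = i) + of_bool (a = j)))" for x :: "real^'n"
    by (simp add: power_add prod.distrib of_bool_def if_distrib[of "\<lambda>n. _ ^ n"] cong: if_cong)
  then show "integrable M (\<lambda>\<omega>. X \<omega> $ i * X \<omega> $ j)"
    and "expectation (\<lambda>\<omega>. X \<omega> $ i * X \<omega> $ j) = of_bool (i = j)"
    using std_gaussian_vector_monomial[OF assms] prod_std_normal_moment_2[of i j]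
    by simp_all
qed

lemma std_gaussian_vector_moment_4:
  fixes X :: "'a \<Rightarrow> real^'n"
  assumes "std_gaussian_vector M X"
  shows "integrable M (\<lambda>\<omega>. X \<omega> $ i * X \<omega> $ j * (X \<omega> $ k * X \<omega> $ l))"
    and "expectation (\<lambda>\<omega>. X \<omega> $ i * X \<omega> $ j * (X \<omega> $ k * X \<omega> $ l)) =
      of_bool (i = j) * of_bool (k = l) + of_bool (i = k) * of_bool (j = l)
      + of_bool (i = l) * of_bool (j = k)"
proof -
  have "x $ i * x $ j * (x $ k * x $ l) =
      (\<Prod>a\<in>UNIV. (x $ a) ^ (of_bool (a = i) + of_bool (a = j) + of_bool (a = k) + of_bool (a = l)))"
    for x :: "real^'n"
    by (simp add: power_add prod.distrib of_bool_def if_distrib[of "\<lambda>n. _ ^ n"] cong: if_cong)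
  then show "integrable M (\<lambda>\<omega>. X \<omega> $ i * X \<omega> $ j * (X \<omega> $ k * X \<omega> $ l))"
    and "expectation (\<lambda>\<omega>. X \<omega> $ i * X \<omega> $ j * (X \<omega> $ k * X \<omega> $ l)) =
      of_bool (i = j) * of_bool (k = l) + of_bool (i = k) * of_bool (j = l)
      + of_bool (i = l) * of_bool (j = k)"
    using std_gaussian_vector_monomial[OF assms] prod_std_normal_moment_4[of i j k l]
    by simp_all
qed

text \<open>Expanding the form over its indices turns its first two moments into sums of Gaussian
  moments of order two and four, weighted by entries of \<open>B\<close>.\<close>

lemma std_gaussian_quadratic_form:
  fixes X :: "'a \<Rightarrow> real^'n" and B :: "real^'n^'n"
  assumes "std_gaussian_vector M X"
  shows "integrable M (\<lambda>\<omega>. X \<omega> \<bullet> (B *v X \<omega>))"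
    and "integrable M (\<lambda>\<omega>. (X \<omega> \<bullet> (B *v X \<omega>))\<^sup>2)"
    and "expectation (\<lambda>\<omega>. X \<omega> \<bullet> (B *v X \<omega>)) = trace B"
    and "transpose B = B \<Longrightarrow> variance (\<lambda>\<omega>. X \<omega> \<bullet> (B *v X \<omega>)) = 2 * (frobenius_norm B)\<^sup>2"
proof -
  let ?q = "\<lambda>x :: real^'n. x \<bullet> (B *v x)"
  have q: "?q x = (\<Sum>i\<in>UNIV. \<Sum>j\<in>UNIV. B $ i $ j * (x $ i * x $ j))" for x
    by (simp add: inner_vec_def matrix_vector_mult_def sum_distrib_left mult_ac)
  have q2: "(?q x)\<^sup>2 = (\<Sum>i\<in>UNIV. \<Sum>j\<in>UNIV. \<Sum>k\<in>UNIV. \<Sum>l\<in>UNIV.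
      B $ i $ j * B $ k $ l * (x $ i * x $ j * (x $ k * x $ l)))" for x
  proof -
    have "(?q x)\<^sup>2 = (\<Sum>i\<in>UNIV. \<Sum>j\<in>UNIV. B $ i $ j * (x $ i * x $ j) * ?q x)"
      using arg_cong[OF q[of x], of "\<lambda>t. t * ?q x"] by (simp only: power2_eq_square sum_distrib_right)
    moreover have "B $ i $ j * (x $ i * x $ j) * ?q x = (\<Sum>k\<in>UNIV. \<Sum>l\<in>UNIV.
        B $ i $ j * B $ k $ l * (x $ i * x $ j * (x $ k * x $ l)))" for i j
      by (simp add: q[of x] sum_distrib_left mult_ac)
    ultimately show ?thesis by simp
  qed
  note m2 = std_gaussian_vector_moment_2[OF assms] and m4 = std_gaussian_vector_moment_4[OF assms]
  show int: "integrable M (\<lambda>\<omega>. X \<omega> \<bullet> (B *v X \<omega>))"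
    unfolding q by (intro Bochner_Integration.integrable_sum integrable_mult_right m2)
  show int2: "integrable M (\<lambda>\<omega>. (X \<omega> \<bullet> (B *v X \<omega>))\<^sup>2)"
    unfolding q2 by (intro Bochner_Integration.integrable_sum integrable_mult_right m4)
  show E: "expectation (\<lambda>\<omega>. X \<omega> \<bullet> (B *v X \<omega>)) = trace B"
    unfolding q by (simp add: m2 trace_def)
  \<comment> \<open>This pulls a condition that does not involve the summation index out of the sum,
    so that the indicators collapse in the nested sums.\<close>
  have [simp]: "(\<Sum>k\<in>UNIV. if P then f k else 0) = (if P then sum f UNIV else 0)"
    for P and f :: "'n \<Rightarrow> real" by simp
  assume sym: "transpose B = B"
  have "expectation (\<lambda>\<omega>. (X \<omega> \<bullet> (B *v X \<omega>))\<^sup>2) =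
     (\<Sum>i\<in>UNIV. \<Sum>j\<in>UNIV. \<Sum>k\<in>UNIV. \<Sum>l\<in>UNIV. B $ i $ j * B $ k $ l *
       (of_bool (i = j) * of_bool (k = l) + of_bool (i = k) * of_bool (j = l)
      + of_bool (i = l) * of_bool (j = k)))"
    unfolding q2 by (simp add: m4)
  \<comment> \<open>The three terms come from the three pairings, in order. The first cancels
    against the squared mean, and symmetry of \<open>B\<close> makes the other two equal, hence the
    factor 2.\<close>
  also have "\<dots> = (trace B)\<^sup>2 + (\<Sum>i\<in>UNIV. \<Sum>j\<in>UNIV. (B $ i $ j)\<^sup>2) + (\<Sum>i\<in>UNIV. \<Sum>j\<in>UNIV. B $ i $ j * B $ j $ i)"
    by (simp add: distrib_left sum.distrib of_bool_def trace_def power2_eq_square sum_product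
       if_distrib[of "\<lambda>x. _ * x"] if_distrib[of "\<lambda>x. x * _"] cong: if_cong)
  also have "(\<Sum>i\<in>UNIV. \<Sum>j\<in>UNIV. B $ i $ j * B $ j $ i) = (\<Sum>i\<in>UNIV. \<Sum>j\<in>UNIV. (B $ i $ j)\<^sup>2)"
    using sym by (simp add: transpose_def vec_eq_iff power2_eq_square)
  also have "(\<Sum>i\<in>UNIV. \<Sum>j\<in>UNIV. (B $ i $ j)\<^sup>2) = (frobenius_norm B)\<^sup>2"
    by (simp add: frobenius_norm_def sum_nonneg)
  finally show "variance (\<lambda>\<omega>. X \<omega> \<bullet> (B *v X \<omega>)) = 2 * (frobenius_norm B)\<^sup>2"
    using variance_eq[OF int int2] E by simp
qed

text \<open>After centering, the cross terms of the squared sum have mean zero by independence, so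
  only the diagonal survives.\<close>

lemma indep_vars_variance_sum:
  fixes X :: "'i \<Rightarrow> 'a \<Rightarrow> real"
  assumes "finite I" "indep_vars (\<lambda>_. borel) X I"
    and "\<And>i. i \<in> I \<Longrightarrow> integrable M (X i)" "\<And>i. i \<in> I \<Longrightarrow> integrable M (\<lambda>\<omega>. (X i \<omega>)\<^sup>2)"
  shows "integrable M (\<lambda>\<omega>. (\<Sum>i\<in>I. X i \<omega> - expectation (X i))\<^sup>2)"
    and "expectation (\<lambda>\<omega>. (\<Sum>i\<in>I. X i \<omega> - expectation (X i))\<^sup>2) = (\<Sum>i\<in>I. variance (X i))"
proof -
  define Y where "Y i \<omega> = X i \<omega> - expectation (X i)" for i \<omega>
  have intY: "integrable M (Y i)" and EY: "expectation (Y i) = 0" if "i \<in> I" for i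
    using assms(3)[OF that] by (simp_all add: Y_def[abs_def] prob_space)
  have indY: "indep_vars (\<lambda>_. borel) Y I"
    unfolding Y_def by (intro indep_vars_compose2[OF assms(2)]) simp
  have YY: "integrable M (\<lambda>\<omega>. Y i \<omega> * Y j \<omega>) \<and>
      expectation (\<lambda>\<omega>. Y i \<omega> * Y j \<omega>) = (if i = j then variance (X i) else 0)"
    if "i \<in> I" "j \<in> I" for i j
  proof (cases "i = j")
    case True
    have "integrable M (\<lambda>\<omega>. (Y i \<omega>)\<^sup>2)"
      using assms(3,4)[OF that(1)] by (simp add: Y_def power2_diff)
    then show ?thesis using True by (simp add: Y_def power2_eq_square)
  next
    case False
    \<comment> \<open>Restricting to a two-element family makes the product rule for independent
      families apply to \<open>Y i * Y j\<close>.\<close>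
    have ind: "indep_vars (\<lambda>_. borel) Y {i, j}"
      using that by (intro indep_vars_subset[OF indY]) auto
    have "integrable M (\<lambda>\<omega>. \<Prod>a\<in>{i, j}. Y a \<omega>)"
      using that intY by (intro indep_vars_integrable ind) auto
    moreover have "expectation (\<lambda>\<omega>. \<Prod>a\<in>{i, j}. Y a \<omega>) = (\<Prod>a\<in>{i, j}. expectation (Y a))"
      using that intY by (intro indep_vars_lebesgue_integral ind) auto
    ultimately show ?thesis using False that by (simp add: EY)
  qed
  have sq: "(\<Sum>i\<in>I. X i \<omega> - expectation (X i))\<^sup>2 = (\<Sum>i\<in>I. \<Sum>j\<in>I. Y i \<omega> * Y j \<omega>)" for \<omega>
    by (simp add: Y_def power2_eq_square sum_product)
  show "integrable M (\<lambda>\<omega>. (\<Sum>i\<in>I. X i \<omega> - expectation (X i))\<^sup>2)"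
    unfolding sq using YY by (intro Bochner_Integration.integrable_sum) auto
  show "expectation (\<lambda>\<omega>. (\<Sum>i\<in>I. X i \<omega> - expectation (X i))\<^sup>2) = (\<Sum>i\<in>I. variance (X i))"
    unfolding sq using YY \<open>finite I\<close> by simp
qed

text \<open>The mean square deviation from \<open>c\<close> exceeds the variance by the square of
  \<open>c - expectation X\<close>. This allows comparison with a convenient constant without
  computing the mean of \<open>X\<close>.\<close>

lemma variance_le_expectation_square_diff:
  fixes X :: "'a \<Rightarrow> real"
  assumes [measurable]: "X \<in> borel_measurable M" and int: "integrable M (\<lambda>\<omega>. (X \<omega> - c)\<^sup>2)"
  shows "integrable M X" and "integrable M (\<lambda>\<omega>. (X \<omega> - expectation X)\<^sup>2)"
    and "variance X \<le> expectation (\<lambda>\<omega>. (X \<omega> - c)\<^sup>2)"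
proof -
  have "integrable M (\<lambda>\<omega>. X \<omega> - c)"
    using int by (rule square_integrable_imp_integrable[rotated]) simp
  then have "integrable M (\<lambda>\<omega>. X \<omega> - c + c)"
    by (intro Bochner_Integration.integrable_add) auto
  then show X: "integrable M X" by simp
  have eq: "(X \<omega> - expectation X)\<^sup>2 = (X \<omega> - c)\<^sup>2 + 2 * (c - expectation X) * (X \<omega> - c) + (c - expectation X)\<^sup>2" for \<omega>
    by (simp add: power2_eq_square algebra_simps)
  show "integrable M (\<lambda>\<omega>. (X \<omega> - expectation X)\<^sup>2)"
    unfolding eq using int X by simp
  have "variance X = expectation (\<lambda>\<omega>. (X \<omega> - c)\<^sup>2) + 2 * (c - expectation X) * (expectation X - c) + (c - expectation X)\<^sup>2"
    unfolding eq using int X by (simp add: prob_space)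
  also have "\<dots> = expectation (\<lambda>\<omega>. (X \<omega> - c)\<^sup>2) - (c - expectation X)\<^sup>2"
    by (simp add: power2_eq_square algebra_simps)
  finally show "variance X \<le> expectation (\<lambda>\<omega>. (X \<omega> - c)\<^sup>2)" by simp
qed

end

section \<open>From the sample mean to its power \<open>1 / p\<close>\<close>

theorem proposition3:
  fixes A :: "real^'n^'n" and p :: real and M :: nat
    and \<Omega> :: "'a measure" and w :: "nat \<Rightarrow> 'a \<Rightarrow> real^'n"
  assumes "prob_space \<Omega>"
    and "psd_matrix A"
    and "p \<ge> 1"
    and "M \<ge> 1"
    and "prob_space.indep_vars \<Omega> (\<lambda>_. borel) w {1..M}"
    and "\<And>j. j \<in> {1..M} \<Longrightarrow> std_gaussian_vector \<Omega> (w j)"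
    and "A \<noteq> 0"
  shows "integrable \<Omega> (schatten_estimator A p M w) \<and>
         integrable \<Omega> (\<lambda>\<omega>. (schatten_estimator A p M w \<omega>
           - prob_space.expectation \<Omega> (schatten_estimator A p M w))\<^sup>2) \<and>
         prob_space.variance \<Omega> (schatten_estimator A p M w)
           \<le> 2 * (frobenius_norm (matrix_powr A p))\<^sup>2
               / (real M * schatten_norm p A powr (2 * p - 2))"
proof -
  interpret prob_space \<Omega> by fact
  define B where "B = matrix_powr A p"
  define T where "T = trace B"
  define Q where "Q = (\<lambda>j \<omega>. w j \<omega> \<bullet> (B *v w j \<omega>))"
  define Y where "Y = (\<lambda>\<omega>. 1 / real M * (\<Sum>j = 1..M. Q j \<omega>))"
  have symA: "transpose A = A" using assms(2) by (simp add: psd_matrix_def)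
  have symB: "transpose B = B" and psdB: "0 \<le> x \<bullet> (B *v x)" for x
    using psd_matrix_powr[OF symA] by (auto simp: psd_matrix_def B_def)
  have T: "0 < T" unfolding T_def B_def by (intro trace_matrix_powr_pos symA assms)
  have Q: "integrable \<Omega> (Q j)" "integrable \<Omega> (\<lambda>\<omega>. (Q j \<omega>)\<^sup>2)" "expectation (Q j) = T"
      "variance (Q j) = 2 * (frobenius_norm B)\<^sup>2" if "j \<in> {1..M}" for j
    using std_gaussian_quadratic_form[OF assms(6)[OF that], of B] symB by (simp_all add: Q_def T_def)
  have indQ: "indep_vars (\<lambda>_. borel) Q {1..M}"
    unfolding Q_def
  proof (rule indep_vars_compose2[OF assms(5)])
    have "continuous_on UNIV (\<lambda>x. x \<bullet> (B *v x))"
      by (intro continuous_intros matrix_vector_mult_linear_continuous_on)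
    then show "(\<lambda>x. x \<bullet> (B *v x)) \<in> borel \<rightarrow>\<^sub>M borel"
      by (rule borel_measurable_continuous_onI)
  qed
  \<comment> \<open>Since every \<open>Q j\<close> has mean \<open>T\<close>, the deviation of
    \<open>Y\<close> is the centered sum divided by \<open>M\<close>; its square carries
    \<open>M\<close> squared, while the variances add up to only \<open>M\<close> equal
    terms.\<close>
  have YT: "(Y \<omega> - T)\<^sup>2 = (\<Sum>j = 1..M. Q j \<omega> - expectation (Q j))\<^sup>2 / (real M)\<^sup>2" for \<omega>
  proof -
    have "Y \<omega> - T = (\<Sum>j = 1..M. Q j \<omega> - T) / real M"
      using assms(4) by (simp add: Y_def sum_subtractf field_simps)
    then show ?thesis using Q by (simp add: power_divide)
  qed
  note var = indep_vars_variance_sum[OF _ indQ Q(1,2), simplified]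
  have intY: "integrable \<Omega> (\<lambda>\<omega>. (Y \<omega> - T)\<^sup>2)"
    unfolding YT using var by simp
  have EY: "expectation (\<lambda>\<omega>. (Y \<omega> - T)\<^sup>2) = 2 * (frobenius_norm B)\<^sup>2 / real M"
    unfolding YT using var Q(4) assms(4) by (simp add: power2_eq_square)
  have Ynn: "0 \<le> Y \<omega>" for \<omega>
    unfolding Y_def Q_def by (intro mult_nonneg_nonneg sum_nonneg psdB) simp
  have [measurable]: "Y \<in> borel_measurable \<Omega>"
    unfolding Y_def using Q(1) by (intro borel_measurable_times borel_measurable_sum) auto
  \<comment> \<open>The constant \<open>c\<close> is the Schatten norm of \<open>A\<close>, written
    through the trace; \<open>s\<close> is the factor supplied by the scalar estimate at
    \<open>y = T\<close>.\<close>
  define c where "c = T powr (1 / p)"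
  define s where "s = T powr (1 - 1 / p)"
  have s: "0 < s" using T by (simp add: s_def)
  have X: "schatten_estimator A p M w = (\<lambda>\<omega>. Y \<omega> powr (1 / p))"
    by (simp add: fun_eq_iff schatten_estimator_def Y_def Q_def B_def)
  have le: "(Y \<omega> powr (1 / p) - c)\<^sup>2 \<le> (Y \<omega> - T)\<^sup>2 / s\<^sup>2" for \<omega>
  proof -
    have "(\<bar>Y \<omega> powr (1 / p) - c\<bar> * s)\<^sup>2 \<le> \<bar>Y \<omega> - T\<bar>\<^sup>2"
      using abs_powr_inverse_diff_le[OF Ynn T assms(3)] s
      unfolding c_def[symmetric] s_def[symmetric] by (intro power_mono) auto
    then show ?thesis using s by (simp add: power_mult_distrib pos_le_divide_eq)
  qed
  \<comment> \<open>The pointwise bound \<open>le\<close> supplies an integrable majorant.\<close>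
  have int: "integrable \<Omega> (\<lambda>\<omega>. (Y \<omega> powr (1 / p) - c)\<^sup>2)"
    using le by (intro Bochner_Integration.integrable_bound[OF integrable_divide[OF intY, of "s\<^sup>2"]]) auto
  have "expectation (\<lambda>\<omega>. (Y \<omega> powr (1 / p) - c)\<^sup>2) \<le> expectation (\<lambda>\<omega>. (Y \<omega> - T)\<^sup>2 / s\<^sup>2)"
    using int intY le by (intro integral_mono) auto
  also have "\<dots> = 2 * (frobenius_norm B)\<^sup>2 / (real M * s\<^sup>2)"
    by (simp add: EY)
  \<comment> \<open>Both sides are \<open>T powr (2 - 2 / p)\<close>, because the Schatten norm is
    \<open>T powr (1 / p)\<close> and \<open>(2 * p - 2) / p = 2 - 2 / p\<close>.\<close>
  also have "s\<^sup>2 = schatten_norm p A powr (2 * p - 2)"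
    using T assms(3) unfolding schatten_norm_eq_trace[OF symA] B_def[symmetric] T_def[symmetric] s_def
    by (simp add: powr_powr powr_realpow[symmetric] powr_power field_simps)
  finally show ?thesis
    using variance_le_expectation_square_diff[OF _ int] unfolding X B_def[symmetric] by fastforce
qed

end
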